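(* Let $\lambda_1\ge\lambda_2\ge\dots\ge\lambda_n$ be real numbers, let $S\le n$, and let $\omega_1,\dots,\omega_S$ be real numbers with $0\le\omega_k\le\lambda_1$ for $k=1,\dots,S$. Suppose that (1) there is a partition $\Lambda_1\cup\dots\cup\Lambda_S$ of the list $\{\lambda_1,\dots,\lambda_n\}$, in which at most one of the $\Lambda_j$ has odd size, with $\Lambda_j=\{\lambda_{j1},\lambda_{j2},\dots,\lambda_{jp_j}\}$, $\lambda_{jk}\ge\lambda_{j(k+1)}$, $\lambda_{j1}\ge 0$, and $\lambda_{11}=\lambda_1$, such that for each $j=1,\dots,S$ the list $\Gamma_j=\{\omega_j,\lambda_{j2},\dots,\lambda_{jp_j}\}$ is the spectrum of a $p_j\times p_j$ nonnegative bisymmetric matrix with Perron root $\omega_j$; and (2) there is an $S\times S$ nonnegative symmetric matrix $B$ with eigenvalues $\lambda_{11},\lambda_{21},\dots,\lambda_{S1}$ and diagonal entries $\omega_1,\omega_2,\dots,\omega_S$. Then $\{\lambda_1,\lambda_2,\dots,\lambda_n\}$ is the spectrum of an $n\times n$ nonnegative bisymmetric matrix.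
   Context: All matrices are real; eigenvalues and spectra are counted with multiplicity. A square matrix $Q$ is bisymmetric if $Q^T=Q$ and $JQJ=Q$, where $J$ is the reverse identity matrix (ones on the anti-diagonal, zeros elsewhere). A matrix is nonnegative if all its entries are $\ge 0$. The Perron root of a nonnegative matrix is its spectral radius, which is an eigenvalue. Lists of numbers are multisets: a partition of a list is obtained from a partition of its index set into nonempty blocks, and sizes are counted with multiplicity. *)

theory Defs
  imports "Jordan_Normal_Form.Spectral_Radius" "Jordan_Normal_Form.Char_Poly"
    "HOL-Library.Disjoint_Sets"
begin

definition reverse_identity :: "nat \<Rightarrow> real mat" where
  "reverse_identity n = mat n n (\<lambda>(i, j). if i + j + 1 = n then 1 else 0)"

definition symmetric_mat :: "real mat \<Rightarrow> bool" where
  "symmetric_mat A \<longleftrightarrow> transpose_mat A = A"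

definition bisymmetric_mat :: "real mat \<Rightarrow> bool" where
  "bisymmetric_mat Q \<longleftrightarrow> square_mat Q \<and> symmetric_mat Q \<and>
     reverse_identity (dim_row Q) * Q * reverse_identity (dim_row Q) = Q"

definition nonneg_mat :: "real mat \<Rightarrow> bool" where
  "nonneg_mat A \<longleftrightarrow> (\<forall>i < dim_row A. \<forall>j < dim_col A. 0 \<le> A $$ (i, j))"

(* All complex eigenvalues of a square real matrix, with algebraic multiplicity. *)
definition spectrum_mset :: "real mat \<Rightarrow> complex multiset" where
  "spectrum_mset A = proots (char_poly (map_mat complex_of_real A))"

(* "A has spectrum M", for a list M of real numbers: in particular, A has no non-real eigenvalue. *)
definition has_spectrum :: "real mat \<Rightarrow> real multiset \<Rightarrow> bool" where
  "has_spectrum A M \<longleftrightarrow> spectrum_mset A = image_mset complex_of_real M"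

definition perron_root :: "real mat \<Rightarrow> real" where
  "perron_root A = spectral_radius (map_mat complex_of_real A)"

end

theory Submission
  imports Defs "HOL-Analysis.Convex"
begin

text \<open>
  Each block is a nonnegative symmetric matrix, so it has a nonnegative Perron eigenvector; adding
  its reversal makes the eigenvector invariant under reversal. Since at most one block has odd
  size, the blocks can be nested around each other like shells, so that their direct sum \<open>A\<close> is
  bisymmetric and the Perron vectors, collected in the columns of a matrix \<open>X\<close> with \<open>X\<^sup>T X = 1\<close> and
  \<open>A X = X \<Omega>\<close>, stay invariant under reversal. Then \<open>Q = A + X (B - \<Omega>) X\<^sup>T\<close> is nonnegative and
  bisymmetric, and by Rado's theorem passing from \<open>A\<close> to \<open>Q\<close> replaces the eigenvalues \<open>\<omega>\<^sub>j\<close> of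
  \<open>A\<close> by those of \<open>B\<close>.
\<close>

unbundle no inner_syntax

section \<open>Perron vectors of symmetric matrices\<close>

lemma smult_mat_mult_vec:
  fixes A :: "'a :: comm_ring mat"
  assumes A: "A \<in> carrier_mat n m" and v: "v \<in> carrier_vec m"
  shows "(c \<cdot>\<^sub>m A) *\<^sub>v v = c \<cdot>\<^sub>v (A *\<^sub>v v)"
  using assms by (intro eq_vecI) auto

lemma transpose_smult_mat: "transpose_mat (c \<cdot>\<^sub>m A) = c \<cdot>\<^sub>m transpose_mat A"
  by (rule eq_matI) auto

lemma pow_mat_add:
  assumes A: "A \<in> carrier_mat n n"
  shows "A ^\<^sub>m (k + l) = A ^\<^sub>m k * A ^\<^sub>m l"
proof (induction l)
  case 0
  then show ?case using pow_carrier_mat[OF A, of k] A by simp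
next
  case (Suc l)
  then show ?case
    using assoc_mult_mat[OF pow_carrier_mat[OF A] pow_carrier_mat[OF A] A, of k l] by simp
qed

lemma transpose_pow_mat:
  fixes A :: "'a :: comm_semiring_1 mat"
  assumes A: "A \<in> carrier_mat n n"
  shows "transpose_mat (A ^\<^sub>m k) = transpose_mat A ^\<^sub>m k"
proof (induction k)
  case 0
  then show ?case using A by simp
next
  case (Suc k)
  have T: "transpose_mat A \<in> carrier_mat n n" using A by simp
  have "transpose_mat (A ^\<^sub>m Suc k) = transpose_mat A * transpose_mat A ^\<^sub>m k"
    using transpose_mult[OF pow_carrier_mat[OF A] A, of k] Suc by simp
  also have "\<dots> = transpose_mat A ^\<^sub>m (1 + k)"
    using pow_mat_add[OF T, of 1 k] T by simp
  finally show ?case by simp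
qed

text \<open>For matrix powers that share an entry bound, this bounds their quadratic forms at
  \<open>v\<close> independently of the exponent.\<close>

lemma norm_bound_quadratic_form:
  fixes A :: "real mat"
  assumes A: "A \<in> carrier_mat n n" and v: "v \<in> carrier_vec n" and b: "norm_bound A b"
  shows "v \<bullet> (A *\<^sub>v v) \<le> b * (\<Sum>i<n. \<bar>v $ i\<bar>)\<^sup>2"
proof -
  have "v \<bullet> (A *\<^sub>v v) = (\<Sum>i<n. \<Sum>j<n. v $ i * (A $$ (i, j) * v $ j))"
    using A v by (auto simp: scalar_prod_def sum_distrib_left atLeast0LessThan intro!: sum.cong)
  also have "\<dots> \<le> (\<Sum>i<n. \<Sum>j<n. b * (\<bar>v $ i\<bar> * \<bar>v $ j\<bar>))"
  proof (intro sum_mono)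
    fix i j assume ij: "i \<in> {..<n}" "j \<in> {..<n}"
    then have "\<bar>A $$ (i, j)\<bar> \<le> b"
      using b A by (auto simp: norm_bound_def)
    then have "\<bar>A $$ (i, j)\<bar> * (\<bar>v $ i\<bar> * \<bar>v $ j\<bar>) \<le> b * (\<bar>v $ i\<bar> * \<bar>v $ j\<bar>)"
      by (intro mult_right_mono) auto
    moreover have "v $ i * (A $$ (i, j) * v $ j) \<le> \<bar>A $$ (i, j)\<bar> * (\<bar>v $ i\<bar> * \<bar>v $ j\<bar>)"
      by (metis abs_ge_self abs_mult mult.left_commute)
    ultimately show "v $ i * (A $$ (i, j) * v $ j) \<le> b * (\<bar>v $ i\<bar> * \<bar>v $ j\<bar>)" by linarith
  qed
  also have "\<dots> = b * (\<Sum>i<n. \<bar>v $ i\<bar>)\<^sup>2"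
    unfolding power2_eq_square sum_product by (simp add: sum_distrib_left)
  finally show ?thesis .
qed

lemma scalar_prod_Cauchy_Schwarz:
  fixes v w :: "real vec"
  assumes "v \<in> carrier_vec n" "w \<in> carrier_vec n"
  shows "(v \<bullet> w)\<^sup>2 \<le> (v \<bullet> v) * (w \<bullet> w)"
  using Cauchy_Schwarz_ineq_sum[of "\<lambda>i. v $ i" "\<lambda>i. w $ i" "{0..<n}"] assms
  by (simp add: scalar_prod_def power2_eq_square)

text \<open>Cauchy--Schwarz gives \<open>(v \<bullet> A\<^sup>k v)\<^sup>2 \<le> |v|\<^sup>2 (v \<bullet> A\<^sup>2\<^sup>k v)\<close>; iterating this along powers of two
  turns a bound on the powers into one on the Rayleigh quotient.\<close>

lemma Rayleigh_le_if_powers_bounded: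
  fixes A :: "real mat"
  assumes A: "A \<in> carrier_mat n n" and sym: "transpose_mat A = A"
    and v: "v \<in> carrier_vec n"
    and bound: "\<And>k. norm_bound (A ^\<^sub>m k) c"
  shows "v \<bullet> (A *\<^sub>v v) \<le> v \<bullet> v"
proof (rule ccontr)
  assume neg: "\<not> ?thesis"
  define s where "s = v \<bullet> v"
  define a where "a k = v \<bullet> (A ^\<^sub>m k *\<^sub>v v)" for k
  \<comment> \<open>The Rayleigh quotient of \<open>v\<close>: once \<open>s\<close> is known to be
    positive, the negated goal says that \<open>r\<close> exceeds 1.\<close>
  define r where "r = a 1 / s"
  define d where "d = c * (\<Sum>i<n. \<bar>v $ i\<bar>)\<^sup>2"
  have a1: "a 1 = v \<bullet> (A *\<^sub>v v)" using A by (simp add: a_def)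
  have sq: "(a k)\<^sup>2 \<le> s * a (2 * k)" for k
  proof -
    have Ak: "A ^\<^sub>m k \<in> carrier_mat n n" using A by simp
    have "a (2 * k) = v \<bullet> (A ^\<^sub>m k *\<^sub>v (A ^\<^sub>m k *\<^sub>v v))"
      using pow_mat_add[OF A, of k k] Ak v by (simp add: a_def mult_2)
    also have "\<dots> = (A ^\<^sub>m k *\<^sub>v v) \<bullet> (A ^\<^sub>m k *\<^sub>v v)"
      using transpose_vec_mult_scalar[OF Ak _ v, of "A ^\<^sub>m k *\<^sub>v v"] Ak v
        transpose_pow_mat[OF A, of k] sym by simp
    finally show ?thesis
      using scalar_prod_Cauchy_Schwarz[OF v, of "A ^\<^sub>m k *\<^sub>v v"] Ak v by (simp add: a_def s_def)
  qed
  have s0: "0 \<le> s" unfolding s_def scalar_prod_def by (intro sum_nonneg) auto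
  have "s \<noteq> 0"
  proof
    assume "s = 0"
    then have "a 1 = 0" using sq[of 1] by simp
    then show False using neg a1 \<open>s = 0\<close> by (simp add: s_def)
  qed
  with s0 have s: "0 < s" by simp
  have r: "1 < r" using neg s a1 by (simp add: r_def s_def field_simps)
  \<comment> \<open>Doubling the exponent squares the lower bound; the extra factor \<open>s\<close>
    on both sides cancels.\<close>
  have low: "s * r ^ (2 ^ k) \<le> a (2 ^ k)" for k
  proof (induction k)
    case 0
    then show ?case using s by (simp add: r_def)
  next
    case (Suc k)
    have "s * (s * r ^ (2 ^ Suc k)) = (s * r ^ (2 ^ k))\<^sup>2"
      by (simp add: power2_eq_square power_add mult_2)
    also have "\<dots> \<le> (a (2 ^ k))\<^sup>2"
      using Suc s r by (intro power_mono) auto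
    also have "\<dots> \<le> s * a (2 ^ Suc k)" using sq[of "2 ^ k"] by simp
    finally show ?case using s by simp
  qed
  have up: "a k \<le> d" for k
    using norm_bound_quadratic_form[OF pow_carrier_mat[OF A] v bound, of k]
    by (simp add: a_def d_def mult_ac)
  have bd: "r ^ (2 ^ k) \<le> d / s" for k
    using order_trans[OF low up, of k] s by (simp add: field_simps)
  \<comment> \<open>The powers of \<open>r\<close> are unbounded, and \<open>k \<le> 2 ^ k\<close>
    carries this over to the exponents that are powers of two.\<close>
  obtain k where k: "d / s < r ^ k"
    using real_arch_pow[of r "d / s"] r by auto
  have "r ^ k \<le> r ^ (2 ^ k)"
    using r by (intro power_increasing) (auto intro: less_imp_le less_exp)
  with k bd[of k] show False by simp
qed


text \<open>For \<open>t\<close> above the spectral radius, \<open>A / t\<close> has spectral radius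
  below 1, so its powers are bounded and the previous lemma gives the inequality with factor
  \<open>t\<close>. Letting \<open>t\<close> decrease to the spectral radius finishes the
  proof.\<close>

lemma Rayleigh_le_spectral_radius:
  fixes A :: "real mat"
  assumes A: "A \<in> carrier_mat n n" and sym: "transpose_mat A = A" and v: "v \<in> carrier_vec n"
  shows "v \<bullet> (A *\<^sub>v v) \<le> spectral_radius (map_mat complex_of_real A) * (v \<bullet> v)"
proof (cases "n = 0")
  case True
  then show ?thesis using v A by (simp add: scalar_prod_def)
next
  case False
  let ?C = "map_mat complex_of_real"
  define \<rho> where "\<rho> = spectral_radius (?C A)"
  have CA: "?C A \<in> carrier_mat n n" using A by simp
  have \<rho>0: "0 \<le> \<rho>"
    using spectral_radius_mem_max(1)[OF CA] False by (auto simp: \<rho>_def)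
  have scaled: "v \<bullet> (A *\<^sub>v v) \<le> t * (v \<bullet> v)" if t: "\<rho> < t" for t
  proof -
    have t0: "0 < t" using \<rho>0 t by simp
    define B where "B = (1 / t) \<cdot>\<^sub>m A"
    have B: "B \<in> carrier_mat n n" and CB: "?C B \<in> carrier_mat n n" using A by (auto simp: B_def)
    have "spectral_radius (?C B) < 1"
    proof -
      obtain \<mu> where \<mu>: "eigenvalue (?C B) \<mu>" "spectral_radius (?C B) = norm \<mu>"
        using spectral_radius_mem_max(1)[OF CB] False by (auto simp: spectrum_def)
      then obtain w where w: "w \<in> carrier_vec n" "w \<noteq> 0\<^sub>v n" "?C B *\<^sub>v w = \<mu> \<cdot>\<^sub>v w"
        using CB by (auto simp: eigenvalue_def eigenvector_def)
      have "?C A = complex_of_real t \<cdot>\<^sub>m ?C B"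
        using t0 by (auto simp: B_def)
      then have "?C A *\<^sub>v w = (of_real t * \<mu>) \<cdot>\<^sub>v w"
        using smult_mat_mult_vec[OF CB w(1), of "of_real t"] w(3)
        by (simp add: smult_smult_assoc)
      then have "eigenvalue (?C A) (of_real t * \<mu>)"
        using w CA by (auto simp: eigenvalue_def eigenvector_def)
      then have "norm (of_real t * \<mu>) \<le> \<rho>"
        using spectral_radius_mem_max(2)[OF CA] False by (auto simp: \<rho>_def spectrum_def)
      then have "t * norm \<mu> \<le> \<rho>" using t0 by (simp add: norm_mult)
      then have "t * norm \<mu> < t * 1" using t by linarith
      then show ?thesis using \<mu>(2) t0 by (simp only: mult_less_cancel_left_pos)
    qed
    then obtain c where c: "\<And>k. norm_bound (?C B ^\<^sub>m k) c"
      using spectral_radius_jnf_norm_bound_less_1_upper_triangular[OF CB] by auto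
    \<comment> \<open>The bound was obtained over the complex numbers; embedding the reals commutes
      with powers and keeps absolute values.\<close>
    have bnd: "norm_bound (B ^\<^sub>m k) c" for k
      using c[of k] B of_real_hom.mat_hom_pow[OF B, where 'a = complex, of k, symmetric]
      by (auto simp: norm_bound_def)
    have symB: "transpose_mat B = B"
      using sym A by (metis B_def transpose_smult_mat)
    have "v \<bullet> (B *\<^sub>v v) \<le> v \<bullet> v"
      by (rule Rayleigh_le_if_powers_bounded[OF B symB v bnd])
    moreover have "B *\<^sub>v v = (1 / t) \<cdot>\<^sub>v (A *\<^sub>v v)"
      unfolding B_def by (rule smult_mat_mult_vec[OF A v])
    ultimately show ?thesis using t0 A v by (simp add: field_simps)
  qed
  have s0: "0 \<le> v \<bullet> v" unfolding scalar_prod_def by (intro sum_nonneg) auto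
  show ?thesis
  proof (rule ccontr)
    assume neg: "\<not> ?thesis"
    \<comment> \<open>If \<open>v \<bullet> v\<close> vanishes, any single \<open>t\<close> gives
      the contradiction; otherwise some \<open>t\<close> lies strictly between the spectral radius
      and the Rayleigh quotient.\<close>
    show False
    proof (cases "v \<bullet> v = 0")
      case True
      then show False using scaled[of "\<rho> + 1"] neg by (simp add: \<rho>_def)
    next
      case False
      with s0 have s: "0 < v \<bullet> v" by simp
      then have "\<rho> < v \<bullet> (A *\<^sub>v v) / (v \<bullet> v)" using neg by (simp add: \<rho>_def field_simps)
      then obtain t where "\<rho> < t" "t < v \<bullet> (A *\<^sub>v v) / (v \<bullet> v)" using dense by blast
      then show False using scaled[of t] s by (simp add: field_simps)
    qed
  qed
qed

text \<open>By the Rayleigh bound \<open>\<omega> - A\<close> is positive semidefinite; taking absolute values in an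
  eigenvector gives a null vector of its quadratic form, hence an element of its kernel.\<close>

lemma Perron_eigenvector:
  fixes A :: "real mat"
  assumes A: "A \<in> carrier_mat n n" and nonneg: "nonneg_mat A" and sym: "transpose_mat A = A"
    and ev: "eigenvalue A (perron_root A)"
  obtains y where "y \<in> carrier_vec n" "y \<noteq> 0\<^sub>v n" "\<And>i. i < n \<Longrightarrow> 0 \<le> y $ i"
    "A *\<^sub>v y = perron_root A \<cdot>\<^sub>v y"
proof -
  define \<omega> where "\<omega> = perron_root A"
  obtain v where v: "v \<in> carrier_vec n" "v \<noteq> 0\<^sub>v n" "A *\<^sub>v v = \<omega> \<cdot>\<^sub>v v"
    using ev A by (auto simp: eigenvalue_def eigenvector_def \<omega>_def)
  define q where "q x = \<omega> * (x \<bullet> x) - x \<bullet> (A *\<^sub>v x)" for x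
  have psd: "0 \<le> q x" if "x \<in> carrier_vec n" for x
    using Rayleigh_le_spectral_radius[OF A sym that] by (simp add: q_def \<omega>_def perron_root_def)
  define y where "y = vec n (\<lambda>i. \<bar>v $ i\<bar>)"
  \<comment> \<open>Half the gradient of \<open>q\<close> at \<open>y\<close>. Since
    \<open>q y\<close> will turn out to be 0, a small move against \<open>z\<close> would make
    \<open>q\<close> negative unless \<open>z\<close> vanishes.\<close>
  define z where "z = \<omega> \<cdot>\<^sub>v y - A *\<^sub>v y"
  have y: "y \<in> carrier_vec n" and z: "z \<in> carrier_vec n" using A by (auto simp: y_def z_def)
  \<comment> \<open>Absolute values keep \<open>v \<bullet> v\<close>, and since \<open>A\<close> is
    nonnegative they cannot decrease \<open>v \<bullet> (A *\<^sub>v v)\<close>.\<close>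
  have "q y \<le> q v"
  proof -
    have "y \<bullet> y = v \<bullet> v" using v by (auto simp: y_def scalar_prod_def)
    moreover have "v \<bullet> (A *\<^sub>v v) \<le> y \<bullet> (A *\<^sub>v y)"
    proof -
      have *: "x \<bullet> (A *\<^sub>v x) = (\<Sum>i<n. \<Sum>j<n. A $$ (i, j) * (x $ i * x $ j))"
        if "x \<in> carrier_vec n" for x
        using A that by (auto simp: scalar_prod_def sum_distrib_left atLeast0LessThan mult_ac
            intro!: sum.cong)
      have "A $$ (i, j) * (v $ i * v $ j) \<le> A $$ (i, j) * (y $ i * y $ j)" if "i < n" "j < n" for i j
        using nonneg A that v
        by (intro mult_left_mono) (auto simp: nonneg_mat_def y_def abs_mult[symmetric])
      then show ?thesis unfolding *[OF v(1)] *[OF y] by (intro sum_mono) auto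
    qed
    ultimately show ?thesis by (simp add: q_def)
  qed
  also have "q v = 0" using v by (simp add: q_def)
  finally have qy: "q y = 0" using psd[OF y] by simp
  have expand: "q (y + t \<cdot>\<^sub>v z) = 2 * t * (z \<bullet> z) + t\<^sup>2 * q z" for t
  proof -
    have c: "A *\<^sub>v y \<in> carrier_vec n" "A *\<^sub>v z \<in> carrier_vec n" "t \<cdot>\<^sub>v z \<in> carrier_vec n"
      "t \<cdot>\<^sub>v (A *\<^sub>v z) \<in> carrier_vec n" "\<omega> \<cdot>\<^sub>v y \<in> carrier_vec n"
      using A y z by auto
    have yz: "y \<bullet> (A *\<^sub>v z) = z \<bullet> (A *\<^sub>v y)"
      using transpose_vec_mult_scalar[OF A z y] sym comm_scalar_prod[of "A *\<^sub>v y" n z] c z by simp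
    have "z \<bullet> z = \<omega> * (z \<bullet> y) - z \<bullet> (A *\<^sub>v y)"
      using scalar_prod_minus_distrib[OF z c(5) c(1)] y z by (simp add: z_def[symmetric])
    then have zz: "z \<bullet> (A *\<^sub>v y) = \<omega> * (z \<bullet> y) - z \<bullet> z" by simp
    have "A *\<^sub>v (y + t \<cdot>\<^sub>v z) = A *\<^sub>v y + t \<cdot>\<^sub>v (A *\<^sub>v z)"
      using mult_add_distrib_mat_vec[OF A y c(3)] mult_mat_vec[OF A z] by simp
    then have "q (y + t \<cdot>\<^sub>v z) = q y + t * (\<omega> * (z \<bullet> y + y \<bullet> z) - y \<bullet> (A *\<^sub>v z) - z \<bullet> (A *\<^sub>v y)) + t\<^sup>2 * q z"
      using y z c by (simp add: q_def scalar_prod_add_distrib[of _ n] add_scalar_prod_distrib[of _ n]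
          algebra_simps power2_eq_square)
    also have "\<dots> = 2 * t * (z \<bullet> z) + t\<^sup>2 * q z"
      using comm_scalar_prod[OF y z] by (simp add: qy yz zz algebra_simps)
    finally show ?thesis .
  qed
  have zz0: "0 \<le> z \<bullet> z" unfolding scalar_prod_def by (intro sum_nonneg) auto
  have "z \<bullet> z = 0"
  proof (rule ccontr)
    assume "z \<bullet> z \<noteq> 0"
    with zz0 have p: "0 < z \<bullet> z" by simp
    \<comment> \<open>This step length makes the linear term outweigh the quadratic one. Adding 1
      keeps the denominator positive even when \<open>q z = 0\<close>.\<close>
    define t where "t = (z \<bullet> z) / (q z + 1)"
    have t: "0 < t" "t * q z < z \<bullet> z" using p psd[OF z] by (auto simp: t_def field_simps)
    have "0 \<le> 2 * (- t) * (z \<bullet> z) + (- t)\<^sup>2 * q z"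
      using psd[of "y + (- t) \<cdot>\<^sub>v z"] y z expand[of "- t"] by simp
    also have "\<dots> = t * (t * q z - 2 * (z \<bullet> z))" by (simp add: power2_eq_square algebra_simps)
    also have "\<dots> < 0" using t p by (intro mult_pos_neg) auto
    finally show False by simp
  qed
  then have "z $ i = 0" if "i < n" for i
    using z that by (simp add: scalar_prod_def sum_nonneg_eq_0_iff)
  then have "A *\<^sub>v y = \<omega> \<cdot>\<^sub>v y"
    using A y by (intro eq_vecI) (auto simp: z_def)
  moreover have "y \<noteq> 0\<^sub>v n"
  proof
    assume "y = 0\<^sub>v n"
    then have "v $ i = 0" if "i < n" for i
      using that by (metis abs_eq_0 index_vec index_zero_vec(1) y_def)
    then have "v = 0\<^sub>v n" using v(1) by (intro eq_vecI) auto
    with v(2) show False ..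
  qed
  ultimately show thesis using that[of y] y by (auto simp: y_def \<omega>_def)
qed

section \<open>Nested direct sums\<close>

lemma reverse_identity_mult_index:
  assumes "A \<in> carrier_mat n m" "i < n" "j < m"
  shows "(reverse_identity n * A) $$ (i, j) = A $$ (n - 1 - i, j)"
proof -
  have "(reverse_identity n * A) $$ (i, j) = (\<Sum>k<n. (if i + k + 1 = n then 1 else 0) * A $$ (k, j))"
    using assms by (simp add: reverse_identity_def scalar_prod_def atLeast0LessThan)
  also have "\<dots> = (\<Sum>k<n. if k = n - 1 - i then A $$ (k, j) else 0)"
    using assms by (intro sum.cong) auto
  finally have "(reverse_identity n * A) $$ (i, j) = \<dots>" .
  then show ?thesis using assms by simp
qed

lemma mult_reverse_identity_index:
  assumes "A \<in> carrier_mat m n" "i < m" "j < n"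
  shows "(A * reverse_identity n) $$ (i, j) = A $$ (i, n - 1 - j)"
proof -
  have "(A * reverse_identity n) $$ (i, j) = (\<Sum>k<n. A $$ (i, k) * (if k + j + 1 = n then 1 else 0))"
    using assms by (simp add: reverse_identity_def scalar_prod_def atLeast0LessThan)
  also have "\<dots> = (\<Sum>k<n. if k = n - 1 - j then A $$ (i, k) else 0)"
    using assms by (intro sum.cong) auto
  finally have "(A * reverse_identity n) $$ (i, j) = \<dots>" .
  then show ?thesis using assms by simp
qed

text \<open>Left multiplication by the reverse identity reverses the rows and right multiplication
  the columns, so together they rotate the matrix by a half turn.\<close>

lemma bisymmetric_mat_iff:
  assumes A: "A \<in> carrier_mat n n"
  shows "bisymmetric_mat A \<longleftrightarrow>
    (\<forall>i<n. \<forall>j<n. A $$ (j, i) = A $$ (i, j) \<and> A $$ (n - 1 - i, n - 1 - j) = A $$ (i, j))"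
proof -
  have J: "reverse_identity n \<in> carrier_mat n n" by (simp add: reverse_identity_def)
  have "(reverse_identity n * A * reverse_identity n) $$ (i, j) = A $$ (n - 1 - i, n - 1 - j)"
    if "i < n" "j < n" for i j
    using that mult_reverse_identity_index[of "reverse_identity n * A" n n i j]
      reverse_identity_mult_index[OF A, of i "n - 1 - j"] A J by simp
  moreover have "reverse_identity n * A * reverse_identity n \<in> carrier_mat n n" using A J by simp
  ultimately have "reverse_identity n * A * reverse_identity n = A \<longleftrightarrow>
      (\<forall>i<n. \<forall>j<n. A $$ (n - 1 - i, n - 1 - j) = A $$ (i, j))"
    using A J by (simp add: mat_eq_iff)
  moreover have "transpose_mat A = A \<longleftrightarrow> (\<forall>i<n. \<forall>j<n. A $$ (j, i) = A $$ (i, j))"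
    using A by (auto simp: mat_eq_iff)
  ultimately show ?thesis
    using A by (auto simp: bisymmetric_mat_def symmetric_mat_def)
qed

text \<open>Rows and columns are permuted alike, so the sign of \<open>\<pi>\<close> occurs twice
  and cancels; injectivity of \<open>\<pi>\<close> keeps the indeterminate on the diagonal.\<close>

lemma char_poly_permute:
  fixes A :: "'a :: comm_ring_1 mat"
  assumes A: "A \<in> carrier_mat n n" and \<pi>: "\<pi> permutes {0..<n}"
  shows "char_poly (mat n n (\<lambda>(i, j). A $$ (\<pi> i, \<pi> j))) = char_poly A"
proof -
  define D where "D = char_poly_matrix A"
  have D: "D \<in> carrier_mat n n" using A by (simp add: D_def)
  have lt: "\<pi> i < n" if "i < n" for i using permutes_in_image[OF \<pi>] that by auto
  define D1 where "D1 = mat n n (\<lambda>(i, j). D $$ (\<pi> i, j))"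
  have D1: "D1 \<in> carrier_mat n n" by (simp add: D1_def)
  \<comment> \<open>Permuting the rows of the transpose permutes the columns of
    \<open>D1\<close>.\<close>
  define D2 where "D2 = mat n n (\<lambda>(i, j). transpose_mat D1 $$ (\<pi> i, j))"
  have D2: "D2 \<in> carrier_mat n n" by (simp add: D2_def)
  have "char_poly_matrix (mat n n (\<lambda>(i, j). A $$ (\<pi> i, \<pi> j))) = transpose_mat D2"
    using A lt permutes_inj[OF \<pi>]
    by (intro eq_matI) (auto simp: char_poly_matrix_def D_def D1_def D2_def dest: injD)
  then have "char_poly (mat n n (\<lambda>(i, j). A $$ (\<pi> i, \<pi> j))) = det D2"
    using det_transpose[OF D2] by (simp add: char_poly_def)
  also have "\<dots> = signof \<pi> * (signof \<pi> * det D)"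
    using det_permute_rows[of "transpose_mat D1" n \<pi>] det_permute_rows[OF D \<pi>] det_transpose[OF D1] D1 \<pi>
    by (simp add: D2_def D1_def)
  also have "\<dots> = det D" by (simp add: sign_def)
  finally show ?thesis by (simp add: D_def char_poly_def)
qed

lemma char_poly_four_block_diag:
  fixes A B :: "'a :: idom mat"
  assumes A: "A \<in> carrier_mat n n" and B: "B \<in> carrier_mat m m"
  shows "char_poly (four_block_mat A (0\<^sub>m n m) (0\<^sub>m m n) B) = char_poly A * char_poly B"
proof -
  have "char_poly_matrix (four_block_mat A (0\<^sub>m n m) (0\<^sub>m m n) B) =
      four_block_mat (char_poly_matrix A) (0\<^sub>m n m) (0\<^sub>m m n) (char_poly_matrix B)"
    using A B by (intro eq_matI) (auto simp: char_poly_matrix_def one_poly_def)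
  then show ?thesis
    using A B by (simp add: char_poly_def det_four_block_mat_lower_left_zero[of _ n _ m])
qed

abbreviation fun_mat :: "nat \<Rightarrow> (nat \<Rightarrow> nat \<Rightarrow> 'a) \<Rightarrow> 'a mat" where
  "fun_mat n a \<equiv> mat n n (\<lambda>(i, j). a i j)"

text \<open>The invariant of the induction over blocks: \<open>F\<close> names the blocks merged so
  far, and the vectors \<open>x k\<close> will become the columns of \<open>X\<close>. With plain
  functions of indices, merging is a matter of index arithmetic.\<close>

definition bisymmetric_system ::
  "nat \<Rightarrow> (nat \<Rightarrow> nat \<Rightarrow> real) \<Rightarrow> nat set \<Rightarrow> (nat \<Rightarrow> real) \<Rightarrow> (nat \<Rightarrow> nat \<Rightarrow> real) \<Rightarrow> bool" where
  "bisymmetric_system n a F \<omega> x \<longleftrightarrow>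
     (\<forall>i<n. \<forall>j<n. 0 \<le> a i j \<and> a j i = a i j \<and> a (n - 1 - i) (n - 1 - j) = a i j) \<and>
     (\<forall>k\<in>F. \<forall>i<n. 0 \<le> x k i \<and> x k (n - 1 - i) = x k i \<and> (\<Sum>j<n. a i j * x k j) = \<omega> k * x k i) \<and>
     (\<forall>k\<in>F. \<forall>l\<in>F. (\<Sum>i<n. x k i * x l i) = (if k = l then 1 else 0))"

lemma sum_lessThan_add:
  fixes f :: "nat \<Rightarrow> 'a :: comm_monoid_add"
  shows "(\<Sum>i<m + n. f i) = (\<Sum>i<m. f i) + (\<Sum>i<n. f (m + i))"
  by (induction n) (simp_all add: add.assoc)

text \<open>The new block is cut in half and wrapped around the old matrix, so that reversal acts on
  both blocks separately; this is where its size has to be even.\<close>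

definition nest :: "nat \<Rightarrow> nat \<Rightarrow> nat \<Rightarrow> nat" where
  "nest m q i = (if i < q then m + i else if i < q + m then i - q else i)"

lemma nest_permutes: "nest m q permutes {0..<m + 2 * q}"
proof (rule bij_imp_permutes)
  have "inj_on (nest m q) {0..<m + 2 * q}"
    by (auto simp: inj_on_def nest_def split: if_splits)
  moreover have "nest m q ` {0..<m + 2 * q} \<subseteq> {0..<m + 2 * q}"
    by (auto simp: nest_def)
  ultimately show "bij_betw (nest m q) {0..<m + 2 * q} {0..<m + 2 * q}"
    by (simp add: bij_betw_def endo_inj_surj)
qed (auto simp: nest_def)

lemma sum_nest:
  fixes f :: "nat \<Rightarrow> 'a :: comm_monoid_add"
  shows "(\<Sum>i<m + 2 * q. f (nest m q i)) = (\<Sum>i<m. f i) + (\<Sum>i<2 * q. f (m + i))"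
  using sum.permute[OF nest_permutes, of f m q] sum_lessThan_add[of f m "2 * q"]
  by (simp add: o_def atLeast0LessThan)

text \<open>In the order of the plain direct sum all conditions split into those of the two blocks,
  and eigenvectors of different blocks have disjoint supports. Reindexing by \<open>nest\<close>
  carries them over, as it turns reversal of all positions into reversal inside each block.\<close>

lemma bisymmetric_system_Un:
  assumes A: "bisymmetric_system m a F \<omega> x" and B: "bisymmetric_system (2 * q) b G \<omega> y"
    and disj: "F \<inter> G = {}"
  obtains c z where "bisymmetric_system (m + 2 * q) c (F \<union> G) \<omega> z"
    "char_poly (fun_mat (m + 2 * q) c) = char_poly (fun_mat m a) * char_poly (fun_mat (2 * q) b)"
proof -
  define d where "d i j = (if i < m \<and> j < m then a i j
    else if m \<le> i \<and> m \<le> j then b (i - m) (j - m) else 0)" for i j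
  define u where "u k i = (if k \<in> F then if i < m then x k i else 0
    else if i < m then 0 else y k (i - m))" for k i
  \<comment> \<open>\<open>nest m q\<close> maps a position in the nested order to an index of the
    direct sum, where the old matrix occupies the first \<open>m\<close> indices.\<close>
  define c where "c i j = d (nest m q i) (nest m q j)" for i j
  define z where "z k i = u k (nest m q i)" for k i
  \<comment> \<open>Reversal inside each block, in direct-sum indices; \<open>rev\<close> identifies
    it with the reversal of nested positions.\<close>
  define \<tau> where "\<tau> i = (if i < m then m - 1 - i else m + (2 * q - 1 - (i - m)))" for i
  let ?N = "m + 2 * q"
  have lt: "nest m q i < ?N" if "i < ?N" for i using that by (auto simp: nest_def)
  have rev: "nest m q (?N - 1 - i) = \<tau> (nest m q i)" if "i < ?N" for i
    using that by (auto simp: nest_def \<tau>_def)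
  have a: "0 \<le> a i j" "a j i = a i j" "a (m - Suc i) (m - Suc j) = a i j" if "i < m" "j < m" for i j
    using A that by (auto simp: bisymmetric_system_def)
  have b: "0 \<le> b i j" "b j i = b i j" "b (2 * q - Suc i) (2 * q - Suc j) = b i j"
    if "i < 2 * q" "j < 2 * q" for i j
    using B that by (auto simp: bisymmetric_system_def)
  have x: "0 \<le> x k i" "x k (m - Suc i) = x k i" "(\<Sum>j<m. a i j * x k j) = \<omega> k * x k i"
    if "k \<in> F" "i < m" for k i
    using A that by (auto simp: bisymmetric_system_def)
  have y: "0 \<le> y k i" "y k (2 * q - Suc i) = y k i" "(\<Sum>j<2 * q. b i j * y k j) = \<omega> k * y k i"
    if "k \<in> G" "i < 2 * q" for k i
    using B that by (auto simp: bisymmetric_system_def)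
  have \<tau>: "\<tau> i < m \<longleftrightarrow> i < m" "i < m \<Longrightarrow> \<tau> i = m - Suc i" "m \<le> i \<Longrightarrow> \<tau> i - m = 2 * q - Suc (i - m)" for i
    by (auto simp: \<tau>_def)
  have d: "0 \<le> d i j \<and> d j i = d i j \<and> d (\<tau> i) (\<tau> j) = d i j" if ij: "i < ?N" "j < ?N" for i j
  proof -
    consider "i < m" "j < m" | "\<not> i < m" "\<not> j < m" | "(i < m) \<noteq> (j < m)" by blast
    then show ?thesis
    proof cases
      case 1
      then have "d i j = a i j" "d j i = a j i" "d (\<tau> i) (\<tau> j) = a (m - Suc i) (m - Suc j)"
        by (simp_all add: d_def \<tau>(1,2))
      then show ?thesis using a[OF 1] by simp
    next
      case 2
      then have lt: "i - m < 2 * q" "j - m < 2 * q" using ij by auto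
      have "d i j = b (i - m) (j - m)" "d j i = b (j - m) (i - m)"
        using 2 by (simp_all add: d_def)
      moreover have "d (\<tau> i) (\<tau> j) = b (\<tau> i - m) (\<tau> j - m)"
        using 2 \<tau>(1)[of i] \<tau>(1)[of j] by (simp add: d_def)
      ultimately show ?thesis using b[OF lt] 2 by (metis \<tau>(3) not_less)
    next
      case 3
      then have "d i j = 0" "d j i = 0" by (auto simp: d_def)
      moreover have "d (\<tau> i) (\<tau> j) = 0" using 3 \<tau>(1)[of i] \<tau>(1)[of j] by (auto simp: d_def)
      ultimately show ?thesis by simp
    qed
  qed
  have F: "k \<in> F \<or> k \<in> G \<and> k \<notin> F" if "k \<in> F \<union> G" for k using that by auto
  have u: "0 \<le> u k i \<and> u k (\<tau> i) = u k i" if "k \<in> F \<union> G" "i < ?N" for k i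
    using that x[of k i] y[of k "i - m"] \<tau>[of i] by (cases "i < m") (auto simp: u_def)
  have du: "(\<Sum>j<m. d i j * u k j) + (\<Sum>j<2 * q. d i (m + j) * u k (m + j)) = \<omega> k * u k i"
    if "k \<in> F \<union> G" "i < ?N" for k i
    using that F[OF that(1)] x(3)[of k i] y(3)[of k "i - m"]
    by (cases "i < m") (auto simp: d_def u_def)
  have uu: "(\<Sum>i<m. u k i * u l i) + (\<Sum>i<2 * q. u k (m + i) * u l (m + i)) = (if k = l then 1 else 0)"
    if "k \<in> F \<union> G" "l \<in> F \<union> G" for k l
    using F[OF that(1)] F[OF that(2)] A B disj by (auto simp: u_def bisymmetric_system_def)
  have "0 \<le> c i j \<and> c j i = c i j \<and> c (?N - 1 - i) (?N - 1 - j) = c i j" if "i < ?N" "j < ?N" for i j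
    unfolding c_def rev[OF that(1)] rev[OF that(2)] by (rule d[OF lt lt]) fact+
  moreover have "0 \<le> z k i \<and> z k (?N - 1 - i) = z k i \<and> (\<Sum>j<?N. c i j * z k j) = \<omega> k * z k i"
    if "k \<in> F \<union> G" "i < ?N" for k i
    unfolding c_def z_def rev[OF that(2)] sum_nest[where f = "\<lambda>j. d _ j * u _ j"]
    using u[OF that(1) lt[OF that(2)]] du[OF that(1) lt[OF that(2)]] by blast
  moreover have "(\<Sum>i<?N. z k i * z l i) = (if k = l then 1 else 0)"
    if "k \<in> F \<union> G" "l \<in> F \<union> G" for k l
    unfolding z_def sum_nest[where f = "\<lambda>j. u _ j * u _ j"] by (rule uu[OF that])
  ultimately have "bisymmetric_system ?N c (F \<union> G) \<omega> z"
    unfolding bisymmetric_system_def by blast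
  moreover have "fun_mat ?N c = mat ?N ?N (\<lambda>(i, j). fun_mat ?N d $$ (nest m q i, nest m q j))"
    using lt by (intro eq_matI) (auto simp: c_def)
  then have "char_poly (fun_mat ?N c) = char_poly (fun_mat ?N d)"
    using char_poly_permute[OF _ nest_permutes, of "fun_mat ?N d" m q] by simp
  moreover have "fun_mat ?N d = four_block_mat (fun_mat m a) (0\<^sub>m m (2 * q)) (0\<^sub>m (2 * q) m) (fun_mat (2 * q) b)"
    by (intro eq_matI) (auto simp: d_def)
  then have "char_poly (fun_mat ?N d) = char_poly (fun_mat m a) * char_poly (fun_mat (2 * q) b)"
    by (simp add: char_poly_four_block_diag)
  ultimately show thesis using that by metis
qed

text \<open>Even blocks are removed one at a time and wrapped around the system of the remaining
  ones, so an odd block can only end up as the core.\<close>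

lemma bisymmetric_system_of_blocks:
  assumes "finite F" "card {k \<in> F. odd (p k)} \<le> 1"
    and "\<And>k. k \<in> F \<Longrightarrow> bisymmetric_system (p k) (a k) {k} \<omega> (x k)"
  shows "\<exists>c z. bisymmetric_system (\<Sum>k\<in>F. p k) c F \<omega> z \<and>
    char_poly (fun_mat (\<Sum>k\<in>F. p k) c) = (\<Prod>k\<in>F. char_poly (fun_mat (p k) (a k)))"
  using assms
proof (induction "card F" arbitrary: F)
  case 0
  then have "F = {}" by simp
  then show ?case by (simp add: bisymmetric_system_def char_poly_def char_poly_matrix_def)
next
  case (Suc r)
  show ?case
  proof (cases "\<exists>k\<in>F. even (p k)")
    case True
    then obtain k q where k: "k \<in> F" "p k = 2 * q" by (auto elim: evenE)
    define F' where "F' = F - {k}"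
    have F: "F = insert k F'" "k \<notin> F'" "finite F'" using k Suc.prems(1) by (auto simp: F'_def)
    have "{l \<in> F'. odd (p l)} = {l \<in> F. odd (p l)}" using F k by auto
    then have odd: "card {l \<in> F'. odd (p l)} \<le> 1" using Suc.prems(2) by simp
    have "r = card F'" using Suc.hyps(2) F by simp
    from Suc.hyps(1)[OF this F(3) odd] Suc.prems(3) F(1) obtain c z where cz:
      "bisymmetric_system (\<Sum>k\<in>F'. p k) c F' \<omega> z"
      "char_poly (fun_mat (\<Sum>k\<in>F'. p k) c) = (\<Prod>k\<in>F'. char_poly (fun_mat (p k) (a k)))"
      by auto
    obtain c' z' where
      "bisymmetric_system ((\<Sum>k\<in>F'. p k) + 2 * q) c' (F' \<union> {k}) \<omega> z'"
      "char_poly (fun_mat ((\<Sum>k\<in>F'. p k) + 2 * q) c') =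
        char_poly (fun_mat (\<Sum>k\<in>F'. p k) c) * char_poly (fun_mat (2 * q) (a k))"
      using bisymmetric_system_Un[OF cz(1), of q "a k" "{k}" "x k"] Suc.prems(3)[OF k(1)] k(2) F(2)
      by auto
    moreover have "F' \<union> {k} = F" "(\<Sum>k\<in>F'. p k) + 2 * q = (\<Sum>k\<in>F. p k)"
      using F k(2) by (auto simp: add.commute)
    moreover have "(\<Prod>k\<in>F'. char_poly (fun_mat (p k) (a k))) * char_poly (fun_mat (2 * q) (a k)) =
        (\<Prod>k\<in>F. char_poly (fun_mat (p k) (a k)))"
      using F k(2) by (simp add: mult.commute)
    ultimately show ?thesis using cz(2) by metis
  next
    case False
    \<comment> \<open>All blocks left are odd, so the parity hypothesis allows only one; it becomes
      the innermost block.\<close>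
    then have "{k \<in> F. odd (p k)} = F" by auto
    then have "card F = 1" using Suc by simp
    then obtain k where "F = {k}" by (auto simp: card_1_singleton_iff)
    then show ?thesis using Suc.prems(3)[of k] by auto
  qed
qed

text \<open>A bisymmetric matrix commutes with reversal, so the reversed Perron vector is an
  eigenvector for the same value. Its sum with the original is invariant under reversal; it is then
  scaled to norm 1.\<close>

lemma bisymmetric_system_single:
  assumes A: "A \<in> carrier_mat n n" and nonneg: "nonneg_mat A" and bisym: "bisymmetric_mat A"
    and ev: "eigenvalue A (perron_root A)" and \<omega>: "\<omega> k = perron_root A"
  shows "\<exists>x. bisymmetric_system n (\<lambda>i j. A $$ (i, j)) {k} \<omega> (\<lambda>_. x)"
proof -
  have sym: "transpose_mat A = A" using bisym by (simp add: bisymmetric_mat_def symmetric_mat_def)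
  have ent: "A $$ (j, i) = A $$ (i, j)" "A $$ (n - 1 - i, n - 1 - j) = A $$ (i, j)"
    if "i < n" "j < n" for i j
    using bisym that unfolding bisymmetric_mat_iff[OF A] by auto
  obtain y where y: "y \<in> carrier_vec n" "y \<noteq> 0\<^sub>v n" "\<And>i. i < n \<Longrightarrow> 0 \<le> y $ i"
    "A *\<^sub>v y = perron_root A \<cdot>\<^sub>v y"
    using Perron_eigenvector[OF A nonneg sym ev] by blast
  have Ay: "(\<Sum>j<n. A $$ (i, j) * y $ j) = \<omega> k * y $ i" if "i < n" for i
    using arg_cong[OF y(4), of "\<lambda>v. v $ i"] that A y(1)
    by (simp add: \<omega> scalar_prod_def atLeast0LessThan)
  have rev: "(\<Sum>j<n. f (n - 1 - j)) = sum f {..<n}" for f :: "nat \<Rightarrow> real"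
    using sum.nat_diff_reindex[of f n] by simp
  \<comment> \<open>The half-turn symmetry of \<open>A\<close> and a reindexing of the sum move the
    reversal from the vector to the row index.\<close>
  have Ay': "(\<Sum>j<n. A $$ (i, j) * y $ (n - 1 - j)) = \<omega> k * y $ (n - 1 - i)" if "i < n" for i
  proof -
    have "(\<Sum>j<n. A $$ (i, j) * y $ (n - 1 - j)) = (\<Sum>j<n. A $$ (n - 1 - i, n - 1 - j) * y $ (n - 1 - j))"
      using ent(2) that by (intro sum.cong) auto
    also have "\<dots> = \<omega> k * y $ (n - 1 - i)"
      using rev[of "\<lambda>j. A $$ (n - 1 - i, j) * y $ j"] Ay[of "n - 1 - i"] that by simp
    finally show ?thesis .
  qed
  define u where "u i = y $ i + y $ (n - 1 - i)" for i
  define s where "s = (\<Sum>i<n. u i * u i)"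
  define x where "x i = u i / sqrt s" for i
  have u: "0 \<le> u i" "u (n - 1 - i) = u i" "(\<Sum>j<n. A $$ (i, j) * u j) = \<omega> k * u i" if "i < n" for i
    using that y(3)[of i] y(3)[of "n - 1 - i"] Ay[of i] Ay'[of i]
    by (auto simp: u_def distrib_left sum.distrib)
  obtain i where i: "i < n" "y $ i \<noteq> 0" using y(1,2) by (metis eq_vecI carrier_vecD index_zero_vec)
  \<comment> \<open>No entry of \<open>y\<close> is negative, so the mirrored summand cannot cancel
    a nonzero entry.\<close>
  have "0 < u i * u i" using i y(3)[of i] y(3)[of "n - 1 - i"] by (auto simp: u_def)
  also have "\<dots> \<le> s" unfolding s_def using i by (intro member_le_sum) auto
  finally have s: "0 < s" .
  have "(\<Sum>i<n. x i * x i) = s / (sqrt s * sqrt s)"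
    by (simp add: x_def s_def sum_divide_distrib)
  then have "(\<Sum>i<n. x i * x i) = 1" using s by simp
  moreover have "0 \<le> x i \<and> x (n - 1 - i) = x i \<and> (\<Sum>j<n. A $$ (i, j) * x j) = \<omega> k * x i"
    if "i < n" for i
  proof -
    have "(\<Sum>j<n. A $$ (i, j) * x j) = (\<Sum>j<n. A $$ (i, j) * u j) / sqrt s"
      by (simp add: x_def sum_divide_distrib)
    then show ?thesis using u[OF that] s by (simp add: x_def)
  qed
  ultimately have "bisymmetric_system n (\<lambda>i j. A $$ (i, j)) {k} \<omega> (\<lambda>_. x)"
    using ent nonneg A by (auto simp: bisymmetric_system_def nonneg_mat_def)
  then show ?thesis by blast
qed

section \<open>Rado's theorem\<close>

text \<open>Both sides are the determinant of
  \<open>[[P, X], [D, 1]] * [[1, -X], [0, R]] = [[P, 0], [D, R - D X]]\<close>.\<close>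

lemma det_update_on_invariant_subspace:
  fixes P :: "'a :: idom mat"
  assumes P: "P \<in> carrier_mat n n" and R: "R \<in> carrier_mat m m"
    and X: "X \<in> carrier_mat n m" and D: "D \<in> carrier_mat m n" and PX: "P * X = X * R"
  shows "det (P - X * D) * det R = det P * det (R - D * X)"
proof -
  define K where "K = four_block_mat P X D (1\<^sub>m m)"
  have XD: "X * D \<in> carrier_mat n n" and DX: "D * X \<in> carrier_mat m m" and XR: "X * R \<in> carrier_mat n m"
    using X D R by auto
  have K: "K \<in> carrier_mat (n + m) (n + m)" using P by (simp add: K_def)
  \<comment> \<open>Subtracting \<open>X\<close> times the lower block row from the upper one clears
    the upper right block, so \<open>det K\<close> is the determinant of the Schur complement
    \<open>P - X * D\<close>.\<close>
  define L where "L = four_block_mat (1\<^sub>m n) (- X) (0\<^sub>m m n) (1\<^sub>m m)"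
  have L: "L \<in> carrier_mat (n + m) (n + m)" by (simp add: L_def)
  have "L * K = four_block_mat (1\<^sub>m n * P + - X * D) (1\<^sub>m n * X + - X * 1\<^sub>m m)
      (0\<^sub>m m n * P + 1\<^sub>m m * D) (0\<^sub>m m n * X + 1\<^sub>m m * 1\<^sub>m m)"
    unfolding L_def K_def by (rule mult_four_block_mat) (use P X D in auto)
  also have "1\<^sub>m n * P + - X * D = P - X * D" using P X D by auto
  also have "1\<^sub>m n * X + - X * 1\<^sub>m m = 0\<^sub>m n m" using X by auto
  also have "0\<^sub>m m n * P + 1\<^sub>m m * D = D" using P D by simp
  also have "0\<^sub>m m n * X + 1\<^sub>m m * 1\<^sub>m m = 1\<^sub>m m" using X by simp
  finally have "det L * det K = det (P - X * D)"
    using det_mult[OF L K] D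
      det_four_block_mat_upper_right_zero[OF minus_carrier_mat[OF XD], of "0\<^sub>m n m" m D "1\<^sub>m m" P]
    by simp
  moreover have "det L = 1"
    unfolding L_def using X by (subst det_four_block_mat_lower_left_zero[of _ n _ m]) auto
  ultimately have detK: "det K = det (P - X * D)" by simp
  define N where "N = four_block_mat (1\<^sub>m n) (- X) (0\<^sub>m m n) R"
  have N: "N \<in> carrier_mat (n + m) (n + m)" using R by (simp add: N_def)
  have "K * N = four_block_mat (P * 1\<^sub>m n + X * 0\<^sub>m m n) (P * - X + X * R)
      (D * 1\<^sub>m n + 1\<^sub>m m * 0\<^sub>m m n) (D * - X + 1\<^sub>m m * R)"
    unfolding N_def K_def by (rule mult_four_block_mat) (use P X D R in auto)
  also have "P * 1\<^sub>m n + X * 0\<^sub>m m n = P" using P X by simp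
  \<comment> \<open>Invariance enters here: \<open>P * X = X * R\<close> clears the upper right
    block.\<close>
  also have "P * - X + X * R = 0\<^sub>m n m"
  proof -
    have "P * - X = - (X * R)" using P X PX by simp
    then show ?thesis using uminus_l_inv_mat[OF XR] by simp
  qed
  also have "D * 1\<^sub>m n + 1\<^sub>m m * 0\<^sub>m m n = D" using D by simp
  also have "D * - X + 1\<^sub>m m * R = R - D * X"
  proof -
    have "D * - X + 1\<^sub>m m * R = - (D * X) + R" using D X R by simp
    also have "\<dots> = R - D * X" using carrier_matD[OF DX] R by (intro eq_matI) auto
    finally show ?thesis .
  qed
  finally have "det K * det N = det P * det (R - D * X)"
    using det_mult[OF K N] D
      det_four_block_mat_upper_right_zero[OF P, of "0\<^sub>m n m" m D "R - D * X"] minus_carrier_mat[OF DX]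
    by simp
  moreover have "det N = det R"
    unfolding N_def using X R by (subst det_four_block_mat_lower_left_zero[of _ n _ m]) auto
  ultimately show ?thesis by (simp add: detK)
qed

text \<open>The determinant identity is applied over the polynomial ring, with the characteristic
  matrices of \<open>A\<close> and \<open>W\<close> as \<open>P\<close> and \<open>R\<close>.
  Keeping \<open>char_poly W\<close> as a factor avoids division; its roots are cancelled later, as
  multisets.\<close>

lemma char_poly_update_on_invariant_subspace:
  fixes A :: "'a :: idom mat"
  assumes A: "A \<in> carrier_mat n n" and W: "W \<in> carrier_mat m m"
    and X: "X \<in> carrier_mat n m" and D: "D \<in> carrier_mat m n" and AX: "A * X = X * W"
  shows "char_poly (A + X * D) * char_poly W = char_poly A * char_poly (W + D * X)"
proof -
  interpret const: comm_ring_hom "\<lambda>a :: 'a. [:a:]"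
    by unfold_locales (auto simp: one_pCons)
  let ?h = "map_mat (\<lambda>a :: 'a. [:a:])"
  let ?t = "[:0, 1:] :: 'a poly"
  have cpm: "char_poly_matrix M = ?t \<cdot>\<^sub>m 1\<^sub>m k - ?h M" if "M \<in> carrier_mat k k" for M k
    using that by (intro eq_matI) (auto simp: char_poly_matrix_def)
  have sum: "char_poly_matrix M - ?h N = char_poly_matrix (M + N)"
    if "M \<in> carrier_mat k k" "N \<in> carrier_mat k k" for M N k
    using that by (intro eq_matI) (auto simp: char_poly_matrix_def)
  have XD: "X * D \<in> carrier_mat n n" and DX: "D * X \<in> carrier_mat m m" and hX: "?h X \<in> carrier_mat n m"
    using X D by auto
  \<comment> \<open>Scalar matrices move past \<open>X\<close>, so \<open>A * X = X * W\<close>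
    lifts to the characteristic matrices.\<close>
  have "char_poly_matrix A * ?h X = (?t \<cdot>\<^sub>m 1\<^sub>m n) * ?h X - ?h A * ?h X"
    unfolding cpm[OF A] using A hX by (intro minus_mult_distrib_mat[of _ n n]) auto
  also have "(?t \<cdot>\<^sub>m 1\<^sub>m n) * ?h X = ?h X * (?t \<cdot>\<^sub>m 1\<^sub>m m)"
    using mult_smult_assoc_mat[of "1\<^sub>m n" n n "?h X" m ?t] hX
      mult_smult_distrib[OF hX, of "1\<^sub>m m" m ?t] by simp
  also have "?h A * ?h X = ?h X * ?h W"
    using const.mat_hom_mult[OF A X] const.mat_hom_mult[OF X W] AX by simp
  also have "?h X * (?t \<cdot>\<^sub>m 1\<^sub>m m) - ?h X * ?h W = ?h X * char_poly_matrix W"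
    unfolding cpm[OF W] using W hX by (intro mult_minus_distrib_mat[symmetric, of _ n m]) auto
  finally have "det (char_poly_matrix A - ?h X * ?h D) * det (char_poly_matrix W)
      = det (char_poly_matrix A) * det (char_poly_matrix W - ?h D * ?h X)"
    using A W X D by (intro det_update_on_invariant_subspace[of _ n _ m]) auto
  then show ?thesis
    unfolding const.mat_hom_mult[OF X D, symmetric] const.mat_hom_mult[OF D X, symmetric]
      sum[OF A XD] sum[OF W DX] char_poly_def .
qed

section \<open>Spectra as multisets of complex roots\<close>

lemma spectrum_mset_conv_char_poly:
  assumes "A \<in> carrier_mat n n"
  shows "spectrum_mset A = proots (map_poly complex_of_real (char_poly A))"
  using of_real_hom.char_poly_hom[OF assms, where 'a = complex] by (simp add: spectrum_mset_def)

lemma char_poly_nonzero: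
  fixes A :: "'a :: idom mat"
  assumes "A \<in> carrier_mat n n"
  shows "char_poly A \<noteq> 0"
  using degree_monic_char_poly[OF assms] by auto

text \<open>Serves the Perron roots: \<open>perron_root\<close> is defined as a complex spectral
  radius, and its occurrence in the prescribed spectrum makes it an eigenvalue of the real
  matrix.\<close>

lemma eigenvalue_if_has_spectrum:
  assumes A: "A \<in> carrier_mat n n" and "has_spectrum A M" "r \<in># M"
  shows "eigenvalue A r"
proof -
  have "complex_of_real r \<in># spectrum_mset A" using assms(2,3) by (simp add: has_spectrum_def)
  then have "poly (map_poly complex_of_real (char_poly A)) (of_real r) = 0"
    using char_poly_nonzero[OF A] by (simp add: spectrum_mset_conv_char_poly[OF A])
  then show ?thesis
    using eigenvalue_root_char_poly[OF A] by simp
qed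

lemma proots_prod_linear_factors: "proots (\<Prod>a\<leftarrow>as. [:- a, 1:]) = mset as"
  for as :: "'a :: idom list"
proof (induction as)
  case (Cons a as)
  have "(\<Prod>a\<leftarrow>as. [:- a, 1:]) \<noteq> 0" by auto
  then show ?case using Cons by (simp add: proots_mult del: mult_pCons_left)
qed simp

lemma spectrum_mset_diagonal:
  assumes "W \<in> carrier_mat m m" "upper_triangular W"
  shows "spectrum_mset W = image_mset complex_of_real (mset (diag_mat W))"
proof -
  let ?W = "map_mat complex_of_real W"
  have "?W \<in> carrier_mat m m" "upper_triangular ?W" using assms by (auto simp: upper_triangular_def)
  then have "spectrum_mset W = proots (\<Prod>a\<leftarrow>map complex_of_real (diag_mat W). [:- a, 1:])"
    unfolding spectrum_mset_def by (simp add: char_poly_upper_triangular diag_mat_map[OF assms(1)])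
  also have "\<dots> = image_mset complex_of_real (mset (diag_mat W))"
    by (simp only: proots_prod_linear_factors mset_map)
  finally show ?thesis .
qed

lemma image_mset_sum_fun: "image_mset f (\<Sum>i\<in>I. g i) = (\<Sum>i\<in>I. image_mset f (g i))"
  by (induction I rule: infinite_finite_induct) auto

lemma image_mset_mset_set_eq_sum:
  "finite I \<Longrightarrow> image_mset g (mset_set I) = (\<Sum>i\<in>I. {#g i#})"
  by (induction I rule: finite_induct) auto


text \<open>Rado's theorem with the Perron vectors as columns of \<open>X\<close> and with
  \<open>D = C * X^T\<close>. Since \<open>X^T * X = 1\<close>, the small matrix
  \<open>W + D * X\<close> is \<open>W + C = B\<close>.\<close>

lemma coupled_system:
  assumes sys: "bisymmetric_system n a {1..S} \<omega> z"
    and B: "B \<in> carrier_mat S S" "nonneg_mat B" "symmetric_mat B" "diag_mat B = map \<omega> [1..<S + 1]"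
  obtains Q where "Q \<in> carrier_mat n n" "nonneg_mat Q" "bisymmetric_mat Q"
    "spectrum_mset Q + image_mset complex_of_real {#\<omega> k. k \<in># mset_set {1..S}#} =
      spectrum_mset (fun_mat n a) + spectrum_mset B"
proof -
  interpret complex_poly: map_poly_inj_idom_hom complex_of_real ..
  define A where "A = fun_mat n a"
  \<comment> \<open>Matrix indices start at 0 and block numbers at 1, hence the shift by
    one.\<close>
  define W where "W = mat S S (\<lambda>(k, l). if k = l then \<omega> (k + 1) else 0)"
  define X where "X = mat n S (\<lambda>(i, k). z (k + 1) i)"
  define C where "C = B - W"
  define Q where "Q = A + X * (C * transpose_mat X)"
  have carr: "A \<in> carrier_mat n n" "W \<in> carrier_mat S S" "X \<in> carrier_mat n S" "C \<in> carrier_mat S S"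
    "transpose_mat X \<in> carrier_mat S n"
    using B(1) by (auto simp: A_def W_def X_def C_def)
  have Q: "Q \<in> carrier_mat n n" using carr by (simp add: Q_def)
  have a: "0 \<le> a i j" "a j i = a i j" "a (n - 1 - i) (n - 1 - j) = a i j" if "i < n" "j < n" for i j
    using sys that by (auto simp: bisymmetric_system_def)
  have z: "0 \<le> z k i" "z k (n - 1 - i) = z k i" "(\<Sum>j<n. a i j * z k j) = \<omega> k * z k i"
    if "k \<in> {1..S}" "i < n" for k i
    using sys that by (auto simp: bisymmetric_system_def)
  have diag: "B $$ (k, k) = \<omega> (k + 1)" if "k < S" for k
    using arg_cong[OF B(4), of "\<lambda>xs. xs ! k"] that B(1) by (simp add: diag_mat_def del: upt_Suc)
  \<comment> \<open>\<open>B\<close> and \<open>W\<close> share their diagonal, so \<open>C\<close>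
    is \<open>B\<close> with zeros on the diagonal; hence the coupling term has no negative
    entries.\<close>
  have C: "0 \<le> C $$ (k, l)" "C $$ (l, k) = C $$ (k, l)" if "k < S" "l < S" for k l
  proof -
    have "B $$ (l, k) = B $$ (k, l)"
      using B(1,3) that by (metis carrier_matD index_transpose_mat(1) symmetric_mat_def)
    then show "C $$ (l, k) = C $$ (k, l)" using B(1) that by (auto simp: C_def W_def)
    show "0 \<le> C $$ (k, l)" using B(1,2) that diag[of k] by (auto simp: C_def W_def nonneg_mat_def)
  qed
  have ent: "Q $$ (i, j) = a i j + (\<Sum>k<S. \<Sum>l<S. z (k + 1) i * (C $$ (k, l) * z (l + 1) j))"
    if "i < n" "j < n" for i j
    using that carr
    by (simp add: Q_def A_def X_def scalar_prod_def sum_distrib_left atLeast0LessThan)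
  have "nonneg_mat Q"
    unfolding nonneg_mat_def
  proof (intro allI impI)
    fix i j assume "i < dim_row Q" "j < dim_col Q"
    then have ij: "i < n" "j < n" using Q by auto
    show "0 \<le> Q $$ (i, j)"
      unfolding ent[OF ij] using ij a z C
      by (intro add_nonneg_nonneg sum_nonneg mult_nonneg_nonneg) auto
  qed
  moreover have "bisymmetric_mat Q"
    unfolding bisymmetric_mat_iff[OF Q]
  proof (intro allI impI conjI)
    fix i j assume ij: "i < n" "j < n"
    \<comment> \<open>Exchanging the two summations swaps \<open>k\<close> and \<open>l\<close>;
      symmetry of \<open>C\<close> restores their order.\<close>
    have "(\<Sum>k<S. \<Sum>l<S. z (k + 1) j * (C $$ (k, l) * z (l + 1) i)) =
        (\<Sum>k<S. \<Sum>l<S. z (k + 1) i * (C $$ (k, l) * z (l + 1) j))"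
      by (subst sum.swap) (use C(2) in \<open>auto simp: mult_ac intro!: sum.cong\<close>)
    then show "Q $$ (j, i) = Q $$ (i, j)"
      using ent[OF ij] ent[OF ij(2,1)] a(2)[OF ij] by simp
    \<comment> \<open>The columns of \<open>X\<close> are invariant under reversal, so a half turn
      fixes the coupling term whatever \<open>C\<close> is.\<close>
    have "n - 1 - i < n" "n - 1 - j < n" using ij by auto
    then show "Q $$ (n - 1 - i, n - 1 - j) = Q $$ (i, j)"
      using ij z(2) a(3)[OF ij] by (simp add: ent)
  qed
  moreover have "transpose_mat X * X = 1\<^sub>m S"
    using sys
    by (intro eq_matI) (auto simp: X_def scalar_prod_def atLeast0LessThan bisymmetric_system_def)
  moreover have "A * X = X * W"
  proof (rule eq_matI)
    fix i k assume "i < dim_row (X * W)" "k < dim_col (X * W)"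
    then have ik: "i < n" "k < S" using carr by auto
    have "(X * W) $$ (i, k) = (\<Sum>l<S. z (l + 1) i * (if l = k then \<omega> (l + 1) else 0))"
      using ik by (simp add: X_def W_def scalar_prod_def atLeast0LessThan)
    also have "\<dots> = (\<Sum>l<S. if l = k then z (l + 1) i * \<omega> (l + 1) else 0)"
      by (intro sum.cong) auto
    finally show "(A * X) $$ (i, k) = (X * W) $$ (i, k)"
      using ik z(3)[of "k + 1" i]
      by (simp add: A_def X_def scalar_prod_def atLeast0LessThan)
  qed (use carr in auto)
  moreover have "W + C = B" using B(1) carr(2) by (auto simp: C_def)
  ultimately have QW: "char_poly Q * char_poly W = char_poly A * char_poly B"
    using char_poly_update_on_invariant_subspace[OF carr(1,2,3), of "C * transpose_mat X"]
      assoc_mult_mat[OF carr(4,5,3)] carr by (simp add: Q_def)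
  have "spectrum_mset Q + spectrum_mset W = spectrum_mset A + spectrum_mset B"
    using arg_cong[OF QW, of "\<lambda>p. proots (map_poly complex_of_real p)"]
      char_poly_nonzero[OF Q] char_poly_nonzero[OF carr(1)] char_poly_nonzero[OF carr(2)]
      char_poly_nonzero[OF B(1)]
    by (simp add: spectrum_mset_conv_char_poly[OF Q] spectrum_mset_conv_char_poly[OF carr(1)]
        spectrum_mset_conv_char_poly[OF carr(2)] spectrum_mset_conv_char_poly[OF B(1)]
        proots_mult complex_poly.hom_mult)
  moreover have "spectrum_mset W = image_mset complex_of_real {#\<omega> k. k \<in># mset_set {1..S}#}"
  proof -
    have "diag_mat W = diag_mat B"
      using B(1) diag by (auto simp: diag_mat_def W_def)
    moreover have "mset [1..<S + 1] = mset_set {1..S}"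
      by (metis Suc_eq_plus1 atLeastLessThanSuc_atLeastAtMost mset_upt)
    ultimately have "mset (diag_mat W) = {#\<omega> k. k \<in># mset_set {1..S}#}"
      by (metis B(4) mset_map)
    then show ?thesis
      using spectrum_mset_diagonal[OF carr(2)] by (auto simp: W_def upper_triangular_def)
  qed
  ultimately show thesis
    using that[of Q] Q \<open>nonneg_mat Q\<close> \<open>bisymmetric_mat Q\<close> by (simp add: A_def)
qed


section \<open>Assembly of the prescribed spectrum\<close>

theorem theorem3p7:
  fixes n S :: nat
    and lam \<omega> :: "nat \<Rightarrow> real"
    and P :: "nat \<Rightarrow> nat set"
    and p :: "nat \<Rightarrow> nat"
    and \<mu> :: "nat \<Rightarrow> nat \<Rightarrow> real"
  assumes lam_decreasing: "\<And>i. 1 \<le> i \<Longrightarrow> i < n \<Longrightarrow> lam (i + 1) \<le> lam i"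
    and S_le: "S \<le> n"
    and omega_bounds: "\<And>k. k \<in> {1..S} \<Longrightarrow> 0 \<le> \<omega> k \<and> \<omega> k \<le> lam 1"
    and blocks_cover: "(\<Union>j\<in>{1..S}. P j) = {1..n}"
    and blocks_disjoint: "disjoint_family_on P {1..S}"
    and blocks_nonempty: "\<And>j. j \<in> {1..S} \<Longrightarrow> P j \<noteq> {}"
    and block_size: "\<And>j. j \<in> {1..S} \<Longrightarrow> p j = card (P j)"
    and at_most_one_odd: "card {j \<in> {1..S}. odd (p j)} \<le> 1"
    and block_list: "\<And>j. j \<in> {1..S} \<Longrightarrow>
          {# \<mu> j k. k \<in># mset_set {1..p j} #} = {# lam i. i \<in># mset_set (P j) #}"
    and block_decreasing: "\<And>j k. j \<in> {1..S} \<Longrightarrow> 1 \<le> k \<Longrightarrow> k < p j \<Longrightarrow> \<mu> j (k + 1) \<le> \<mu> j k"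
    and block_head_nonneg: "\<And>j. j \<in> {1..S} \<Longrightarrow> 0 \<le> \<mu> j 1"
    and first_head: "\<mu> 1 1 = lam 1"
    and block_matrices: "\<And>j. j \<in> {1..S} \<Longrightarrow>
          \<exists>A \<in> carrier_mat (p j) (p j). nonneg_mat A \<and> bisymmetric_mat A \<and>
            has_spectrum A (add_mset (\<omega> j) {# \<mu> j k. k \<in># mset_set {2..p j} #}) \<and>
            perron_root A = \<omega> j"
    and omega_diagonal: "\<exists>B \<in> carrier_mat S S. nonneg_mat B \<and> symmetric_mat B \<and>
            has_spectrum B {# \<mu> j 1. j \<in># mset_set {1..S} #} \<and>
            diag_mat B = map \<omega> [1..<S + 1]"
  shows "\<exists>Q \<in> carrier_mat n n. nonneg_mat Q \<and> bisymmetric_mat Q \<and>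
           has_spectrum Q {# lam i. i \<in># mset_set {1..n} #}"
proof -
  interpret complex_poly: map_poly_inj_idom_hom complex_of_real ..
  have "\<exists>M. \<forall>j\<in>{1..S}. M j \<in> carrier_mat (p j) (p j) \<and> nonneg_mat (M j) \<and>
      bisymmetric_mat (M j) \<and>
      has_spectrum (M j) (add_mset (\<omega> j) {# \<mu> j k. k \<in># mset_set {2..p j} #}) \<and>
      perron_root (M j) = \<omega> j"
    using block_matrices by (intro bchoice) blast
  then obtain M where M: "\<And>j. j \<in> {1..S} \<Longrightarrow> M j \<in> carrier_mat (p j) (p j)"
    "\<And>j. j \<in> {1..S} \<Longrightarrow> nonneg_mat (M j)" "\<And>j. j \<in> {1..S} \<Longrightarrow> bisymmetric_mat (M j)"
    "\<And>j. j \<in> {1..S} \<Longrightarrow> has_spectrum (M j) (add_mset (\<omega> j) {# \<mu> j k. k \<in># mset_set {2..p j} #})"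
    "\<And>j. j \<in> {1..S} \<Longrightarrow> perron_root (M j) = \<omega> j"
    by blast
  have "\<exists>x. bisymmetric_system (p j) (\<lambda>i k. M j $$ (i, k)) {j} \<omega> (\<lambda>_. x)" if j: "j \<in> {1..S}" for j
  proof (rule bisymmetric_system_single)
    show "eigenvalue (M j) (perron_root (M j))"
      using eigenvalue_if_has_spectrum[OF M(1,4)[OF j], of "\<omega> j"] M(5)[OF j] by simp
  qed (use M j in auto)
  then obtain x where x: "\<And>j. j \<in> {1..S} \<Longrightarrow>
      bisymmetric_system (p j) (\<lambda>i k. M j $$ (i, k)) {j} \<omega> (\<lambda>_. x j)"
    by metis
  obtain B where B: "B \<in> carrier_mat S S" "nonneg_mat B" "symmetric_mat B"
    "has_spectrum B {# \<mu> j 1. j \<in># mset_set {1..S} #}" "diag_mat B = map \<omega> [1..<S + 1]"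
    using omega_diagonal by blast
  have finP: "finite (P j)" if "j \<in> {1..S}" for j
    using that blocks_cover by (metis UN_upper finite_atLeastAtMost finite_subset)
  have disj: "\<forall>i\<in>{1..S}. \<forall>j\<in>{1..S}. i \<noteq> j \<longrightarrow> P i \<inter> P j = {}"
    using blocks_disjoint by (auto simp: disjoint_family_on_def)
  have "(\<Sum>j\<in>{1..S}. p j) = card (\<Union>j\<in>{1..S}. P j)"
    using finP disj block_size by (subst card_UN_disjoint) auto
  then have n: "(\<Sum>j\<in>{1..S}. p j) = n" unfolding blocks_cover by simp
  obtain c z where cz: "bisymmetric_system n c {1..S} \<omega> z"
    "char_poly (fun_mat n c) = (\<Prod>j\<in>{1..S}. char_poly (fun_mat (p j) (\<lambda>i k. M j $$ (i, k))))"
    using bisymmetric_system_of_blocks[OF _ at_most_one_odd x] unfolding n by auto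
  obtain Q where Q: "Q \<in> carrier_mat n n" "nonneg_mat Q" "bisymmetric_mat Q"
    "spectrum_mset Q + image_mset complex_of_real {#\<omega> k. k \<in># mset_set {1..S}#} =
      spectrum_mset (fun_mat n c) + spectrum_mset B"
    using coupled_system[OF cz(1) B(1-3,5)] by blast
  have blk: "fun_mat (p j) (\<lambda>i k. M j $$ (i, k)) = M j" if "j \<in> {1..S}" for j
    using M(1)[OF that] by (intro eq_matI) auto
  \<comment> \<open>The characteristic polynomial of the nested sum is the product over the blocks,
    so the spectra add up.\<close>
  have "spectrum_mset (fun_mat n c) = (\<Sum>j\<in>{1..S}. spectrum_mset (M j))"
  proof -
    have "map_poly complex_of_real (\<Prod>j\<in>{1..S}. char_poly (M j)) =
        (\<Prod>j\<in>{1..S}. map_poly complex_of_real (char_poly (M j)))"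
      by (rule complex_poly.hom_prod)
    moreover have "char_poly (fun_mat n c) = (\<Prod>j\<in>{1..S}. char_poly (M j))"
      unfolding cz(2) by (intro prod.cong) (simp_all only: blk)
    ultimately show ?thesis
      using proots_prod[of "{1..S}" "\<lambda>j. map_poly complex_of_real (char_poly (M j))"]
        char_poly_nonzero[OF M(1)]
      by (simp add: spectrum_mset_conv_char_poly[of _ n] spectrum_mset_conv_char_poly[OF M(1)])
  qed
  also have "\<dots> = (\<Sum>j\<in>{1..S}. image_mset complex_of_real
      ({#\<omega> j#} + {# \<mu> j k. k \<in># mset_set {2..p j} #}))"
    using M(4) by (intro sum.cong) (auto simp: has_spectrum_def)
  also have "\<dots> = image_mset complex_of_real
      ({#\<omega> k. k \<in># mset_set {1..S}#} + (\<Sum>j\<in>{1..S}. {# \<mu> j k. k \<in># mset_set {2..p j} #}))"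
    by (simp only: image_mset_sum_fun sum.distrib image_mset_union image_mset_mset_set_eq_sum finite_atLeastAtMost)
  \<comment> \<open>The values \<open>\<omega> k\<close> on both sides cancel, and the eigenvalues
    \<open>\<mu> j 1\<close> of \<open>B\<close> take their place.\<close>
  finally have "spectrum_mset Q = image_mset complex_of_real
      ({# \<mu> j 1. j \<in># mset_set {1..S} #} + (\<Sum>j\<in>{1..S}. {# \<mu> j k. k \<in># mset_set {2..p j} #}))"
    using Q(4) B(4) by (simp add: has_spectrum_def add_ac)
  also have "{# \<mu> j 1. j \<in># mset_set {1..S} #} + (\<Sum>j\<in>{1..S}. {# \<mu> j k. k \<in># mset_set {2..p j} #}) =
      (\<Sum>j\<in>{1..S}. {# \<mu> j 1 #} + {# \<mu> j k. k \<in># mset_set {2..p j} #})"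
    by (simp only: sum.distrib image_mset_mset_set_eq_sum finite_atLeastAtMost)
  also have "\<dots> = (\<Sum>j\<in>{1..S}. {# lam i. i \<in># mset_set (P j) #})"
  proof (intro sum.cong refl)
    fix j assume j: "j \<in> {1..S}"
    \<comment> \<open>A nonempty block has a head, so the index 1 can be split off from
      \<open>{1..p j}\<close>.\<close>
    have "1 \<le> p j"
      using finP[OF j] blocks_nonempty[OF j] block_size[OF j] by (simp add: Suc_le_eq card_gt_0_iff)
    then have "{1..p j} = insert 1 {2..p j}" by auto
    then show "{# \<mu> j 1 #} + {# \<mu> j k. k \<in># mset_set {2..p j} #} = {# lam i. i \<in># mset_set (P j) #}"
      using block_list[OF j] by simp
  qed
  also have "\<dots> = {# lam i. i \<in># mset_set {1..n} #}"
    unfolding blocks_cover[symmetric]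
    using finP disj by (simp add: image_mset_mset_set_eq_sum sum.UNION_disjoint)
  finally have "has_spectrum Q {# lam i. i \<in># mset_set {1..n} #}"
    by (simp add: has_spectrum_def)
  with Q show ?thesis by blast
qed

end
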